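(* Let $R$ be a commutative ring with unity that has at least one nontrivial idempotent. Then: (i) If $U''(R)=\emptyset$ and $\mathrm{Cl}_2(R)$ is not a complete graph, then $\mathrm{Cl}_2(R)_{SR}=K_{|U(R)|}+K$, i.e. $\mathrm{Cl}_2(R)_{SR}$ is the disjoint union of the graph $K$ and a complete graph on $|U(R)|$ vertices. (ii) If $U''(R)\neq\emptyset$ and $\mathrm{Cl}_2(R)$ is not a complete graph, then $\mathrm{Cl}_2(R)_{SR}\cong H'$. (iii) $V(\mathrm{Cl}_2(R))=V(\mathrm{Cl}_2(R)_{SR})$.
   Context: All rings are commutative with unity. $U(R)$ is the set of units, $\mathrm{Id}(R)$ the set of idempotents, $U'(R)=\{u\in U(R):u^2=1\}$, $U''(R)=U(R)\setminus U'(R)$. The clean graph $\mathrm{Cl}(R)$ has vertex set $\{(e,u): e\in\mathrm{Id}(R), u\in U(R)\}$, two distinct vertices $(e,u),(f,v)$ being adjacent iff $ef=0$ or $uv=1$; $\mathrm{Cl}_2(R)$ is its subgraph induced by the vertices $(e,u)$ with $e\neq 0$. In a connected graph $\Gamma$ with distance $d$ and neighbourhoods $N(x)$, $x$ is maximally distant from $y$ if $d(y,w)\le d(x,y)$ for all $w\in N(x)$, and $x,y$ are mutually maximally distant (MMD) if each is maximally distant from the other. The strong resolving graph $\Gamma_{SR}$ has as vertex set the set of vertices of $\Gamma$ that are MMD with some vertex, two vertices being adjacent iff they are MMD in $\Gamma$. $K$ is the graph with vertex set $\{(e,u): e\in\mathrm{Id}(R)\setminus\{0,1\}, u\in U(R)\}$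 in which distinct $(e,u),(f,v)$ are adjacent iff $ef\neq 0$ and $uv\neq 1$. $H'$ is the graph with vertex set $V(\mathrm{Cl}_2(R))$ in which distinct $(e,u),(f,v)$ are adjacent iff one of: (1) $e=f=1$ and $uv\neq 1$; (2) $e\neq1$, $f\neq 1$, $ef\neq 0$ and $uv\neq 1$; (3) exactly one of $e,f$ equals $1$ and $u=v\in U''(R)$. $K_m$ is the complete graph on $m$ vertices and $+$ denotes disjoint union. *)

theory Defs
  imports
    "HOL-Algebra.Ring"
    "HOL-Library.Equipollence"
    "Graph_Theory.Graph_Theory"
begin

text \<open>
  A simple undirected graph, possibly infinite, is rendered as a symmetric loop-free digraph whose
  arcs are ordered pairs of vertices. The relation \<open>adj\<close> is only consulted at distinct vertices.
\<close>

definition simple_graph :: "'v set \<Rightarrow> ('v \<Rightarrow> 'v \<Rightarrow> bool) \<Rightarrow> ('v, 'v \<times> 'v) pre_digraph" where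
  "simple_graph V adj =
     with_proj \<lparr>pverts = V, parcs = {(x, y). x \<in> V \<and> y \<in> V \<and> x \<noteq> y \<and> adj x y}\<rparr>"

lemma verts_simple_graph [simp]: "verts (simple_graph V adj) = V"
  by (simp add: simple_graph_def)

lemma simple_graph_dominates_iff [simp]:
  "x \<rightarrow>\<^bsub>simple_graph V adj\<^esub> y \<longleftrightarrow> x \<in> V \<and> y \<in> V \<and> x \<noteq> y \<and> adj x y"
  by (simp add: simple_graph_def)

lemma wf_digraph_simple_graph: "wf_digraph (simple_graph V adj)"
  by unfold_locales (auto simp: simple_graph_def)

definition complete_graph :: "'v set \<Rightarrow> ('v, 'v \<times> 'v) pre_digraph" where
  "complete_graph V = simple_graph V (\<lambda>_ _. True)"

definition is_complete :: "('v, 'e) pre_digraph \<Rightarrow> bool" where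
  "is_complete G \<longleftrightarrow> (\<forall>x \<in> verts G. \<forall>y \<in> verts G. x \<noteq> y \<longrightarrow> x \<rightarrow>\<^bsub>G\<^esub> y)"

definition is_disjoint_union ::
    "('v, 'e) pre_digraph \<Rightarrow> ('v, 'e) pre_digraph \<Rightarrow> ('v, 'e) pre_digraph \<Rightarrow> bool" where
  "is_disjoint_union G G1 G2 \<longleftrightarrow> verts G1 \<inter> verts G2 = {} \<and> G = union G1 G2"

text \<open>The distance is infinite between vertices that are not joined by a walk.\<close>

definition graph_dist :: "('v, 'e) pre_digraph \<Rightarrow> 'v \<Rightarrow> 'v \<Rightarrow> ereal" where
  "graph_dist G x y = wf_digraph.\<mu> G (\<lambda>_. 1) x y"

definition maximally_distant :: "('v, 'e) pre_digraph \<Rightarrow> 'v \<Rightarrow> 'v \<Rightarrow> bool" where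
  "maximally_distant G x y \<longleftrightarrow>
     (\<forall>w. x \<rightarrow>\<^bsub>G\<^esub> w \<longrightarrow> graph_dist G y w \<le> graph_dist G x y)"

definition MMD :: "('v, 'e) pre_digraph \<Rightarrow> 'v \<Rightarrow> 'v \<Rightarrow> bool" where
  "MMD G x y \<longleftrightarrow> maximally_distant G x y \<and> maximally_distant G y x"

definition strong_resolving_graph :: "('v, 'e) pre_digraph \<Rightarrow> ('v, 'v \<times> 'v) pre_digraph" where
  "strong_resolving_graph G =
     simple_graph {x \<in> verts G. \<exists>y \<in> verts G. MMD G x y} (MMD G)"

definition idempotents :: "('a, 'm) ring_scheme \<Rightarrow> 'a set" where
  "idempotents R = {e \<in> carrier R. e \<otimes>\<^bsub>R\<^esub> e = e}"

definition Units' :: "('a, 'm) ring_scheme \<Rightarrow> 'a set" where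
  "Units' R = {u \<in> Units R. u [^]\<^bsub>R\<^esub> (2::nat) = \<one>\<^bsub>R\<^esub>}"

definition Units'' :: "('a, 'm) ring_scheme \<Rightarrow> 'a set" where
  "Units'' R = Units R - Units' R"

definition Cl :: "('a, 'm) ring_scheme \<Rightarrow> ('a \<times> 'a, ('a \<times> 'a) \<times> ('a \<times> 'a)) pre_digraph" where
  "Cl R = simple_graph (idempotents R \<times> Units R)
     (\<lambda>(e, u) (f, v). e \<otimes>\<^bsub>R\<^esub> f = \<zero>\<^bsub>R\<^esub> \<or> u \<otimes>\<^bsub>R\<^esub> v = \<one>\<^bsub>R\<^esub>)"

definition Cl2 :: "('a, 'm) ring_scheme \<Rightarrow> ('a \<times> 'a, ('a \<times> 'a) \<times> ('a \<times> 'a)) pre_digraph" where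
  "Cl2 R = Cl R \<restriction> {(e, u) \<in> verts (Cl R). e \<noteq> \<zero>\<^bsub>R\<^esub>}"

definition K_graph ::
    "('a, 'm) ring_scheme \<Rightarrow> ('a \<times> 'a, ('a \<times> 'a) \<times> ('a \<times> 'a)) pre_digraph" where
  "K_graph R = simple_graph ((idempotents R - {\<zero>\<^bsub>R\<^esub>, \<one>\<^bsub>R\<^esub>}) \<times> Units R)
     (\<lambda>(e, u) (f, v). e \<otimes>\<^bsub>R\<^esub> f \<noteq> \<zero>\<^bsub>R\<^esub> \<and> u \<otimes>\<^bsub>R\<^esub> v \<noteq> \<one>\<^bsub>R\<^esub>)"

definition H'_graph ::
    "('a, 'm) ring_scheme \<Rightarrow> ('a \<times> 'a, ('a \<times> 'a) \<times> ('a \<times> 'a)) pre_digraph" where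
  "H'_graph R = simple_graph (verts (Cl2 R))
     (\<lambda>(e, u) (f, v).
        (e = \<one>\<^bsub>R\<^esub> \<and> f = \<one>\<^bsub>R\<^esub> \<and> u \<otimes>\<^bsub>R\<^esub> v \<noteq> \<one>\<^bsub>R\<^esub>)
      \<or> (e \<noteq> \<one>\<^bsub>R\<^esub> \<and> f \<noteq> \<one>\<^bsub>R\<^esub> \<and> e \<otimes>\<^bsub>R\<^esub> f \<noteq> \<zero>\<^bsub>R\<^esub> \<and> u \<otimes>\<^bsub>R\<^esub> v \<noteq> \<one>\<^bsub>R\<^esub>)
      \<or> ((e = \<one>\<^bsub>R\<^esub>) \<noteq> (f = \<one>\<^bsub>R\<^esub>) \<and> u = v \<and> u \<in> Units'' R))"

end

theory Submission
  imports Defs "HOL-Algebra.Multiplicative_Group"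
begin

text \<open>
  Two distinct non-adjacent vertices \<open>(e, u)\<close> and \<open>(f, v)\<close> of \<open>Cl2 R\<close> are at distance 3 if
  \<open>e = f = 1\<close>, since the neighbours of \<open>(1, u)\<close> are exactly the vertices \<open>(g, inv u)\<close>, and at distance
  2 otherwise. So such a pair is automatically mutually maximally distant unless exactly one of
  \<open>e, f\<close> is 1; in that case the only obstruction is the neighbour \<open>(1, inv v)\<close> of \<open>(f, v)\<close>, which
  lies at distance 3 from \<open>(1, u)\<close> unless \<open>u = v\<close>. Adjacent vertices are mutually maximally distant
  only if they have the same closed neighbourhood, and comparing the neighbours \<open>(1, inv u)\<close> and
  \<open>(1 - e, w)\<close> of \<open>(e, u)\<close> excludes this as soon as there is a unit other than 1. Hence the strong
  resolving graph is literally \<open>H'\<close> whenever \<open>Cl2 R\<close> is not complete.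
\<close>

section \<open>Distances in digraphs\<close>

text \<open>With unit weights the cost of a walk is its length, so the infimum defining the distance
  runs over natural numbers: if no walk has length at most \<open>n\<close>, all costs are at least
  \<open>Suc n\<close>. An empty set of walks, with infinite infimum, is covered too.\<close>

lemma graph_dist_le_iff:
  assumes "wf_digraph G"
  shows "graph_dist G x y \<le> ereal (real n) \<longleftrightarrow>
    (\<exists>p. pre_digraph.awalk G x p y \<and> length p \<le> n)"
proof -
  interpret wf_digraph G by fact
  have cost: "awalk_cost (\<lambda>_. 1) p = real (length p)" for p
    by (induction p) auto
  show ?thesis
  proof
    assume le: "graph_dist G x y \<le> ereal (real n)"
    show "\<exists>p. awalk x p y \<and> length p \<le> n"
    proof (rule ccontr)
      assume "\<not> ?thesis"
      then have "ereal (real (Suc n)) \<le> graph_dist G x y"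
        unfolding graph_dist_def \<mu>_def by (intro INF_greatest) (auto simp: cost)
      with le have "ereal (real (Suc n)) \<le> ereal (real n)"
        by (rule order_trans[rotated])
      then show False by simp
    qed
  next
    assume "\<exists>p. awalk x p y \<and> length p \<le> n"
    then obtain p where p: "awalk x p y" "length p \<le> n" by blast
    then have "graph_dist G x y \<le> ereal (real (length p))"
      using min_cost_le_walk_cost[of x p y "\<lambda>_. 1"] by (simp add: graph_dist_def cost)
    also have "\<dots> \<le> ereal (real n)" using p by simp
    finally show "graph_dist G x y \<le> ereal (real n)" .
  qed
qed

lemma graph_dist_le_0_iff:
  assumes "wf_digraph G"
  shows "graph_dist G x y \<le> ereal (real 0) \<longleftrightarrow> x = y \<and> x \<in> verts G"
  unfolding graph_dist_le_iff[OF assms] by (auto simp: wf_digraph.awalk_Nil_iff[OF assms])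

text \<open>Splitting off the first arc of a walk gives a recursion by which the bounds 1, 2 and 3
  are unfolded into adjacency statements.\<close>

lemma graph_dist_le_Suc_iff:
  assumes "wf_digraph G"
  shows "graph_dist G x y \<le> ereal (real (Suc n)) \<longleftrightarrow>
    x = y \<and> x \<in> verts G \<or> (\<exists>z. x \<rightarrow>\<^bsub>G\<^esub> z \<and> graph_dist G z y \<le> ereal (real n))"
proof -
  interpret wf_digraph G by fact
  have "(\<exists>p. awalk x p y \<and> length p \<le> Suc n) \<longleftrightarrow>
    x = y \<and> x \<in> verts G \<or> (\<exists>z. x \<rightarrow>\<^bsub>G\<^esub> z \<and> (\<exists>p. awalk z p y \<and> length p \<le> n))"
    (is "?L \<longleftrightarrow> ?R")
  proof
    assume ?L
    then obtain p where p: "awalk x p y" "length p \<le> Suc n" by blast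
    show ?R
    proof (cases p)
      case Nil
      then show ?thesis using p by (auto simp: awalk_Nil_iff)
    next
      case (Cons a q)
      then have "x \<rightarrow>\<^bsub>G\<^esub> head G a" "awalk (head G a) q y" "length q \<le> n"
        using p by (auto simp: awalk_Cons_iff intro: in_arcs_imp_in_arcs_ends)
      then show ?thesis by blast
    qed
  next
    assume ?R
    then show ?L
    proof (elim disjE exE conjE)
      assume "x = y" "x \<in> verts G"
      then have "awalk x [] y" by (simp add: awalk_Nil_iff)
      then show ?L by (metis le0 list.size(3))
    next
      fix z p assume "x \<rightarrow>\<^bsub>G\<^esub> z" and p: "awalk z p y" "length p \<le> n"
      then obtain a where "a \<in> arcs G" "tail G a = x" "head G a = z"
        by (auto simp: arcs_ends_conv)
      then have "awalk x (a # p) y" using p by (simp add: awalk_Cons_iff)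
      then show ?L using p by (metis Suc_le_mono length_Cons)
    qed
  qed
  then show ?thesis by (simp only: graph_dist_le_iff[OF assms])
qed

lemma graph_dist_eq_0:
  assumes "wf_digraph G" "x \<in> verts G"
  shows "graph_dist G x x = ereal (real 0)"
proof (rule antisym)
  interpret wf_digraph G by fact
  show "graph_dist G x x \<le> ereal (real 0)"
    using assms by (simp only: graph_dist_le_0_iff)
  show "ereal (real 0) \<le> graph_dist G x x"
    unfolding graph_dist_def \<mu>_def
    by (intro INF_greatest) (auto simp: awalk_cost_def intro!: sum_list_nonneg)
qed

text \<open>Lengths are integers, so a distance exceeding \<open>n\<close> is already at least
  \<open>Suc n\<close>, although its type is \<open>ereal\<close>.\<close>

lemma graph_dist_eq_SucI:
  assumes "wf_digraph G"
    and "graph_dist G x y \<le> ereal (real (Suc n))" "\<not> graph_dist G x y \<le> ereal (real n)"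
  shows "graph_dist G x y = ereal (real (Suc n))"
proof (rule antisym)
  interpret wf_digraph G by fact
  have "\<not> (\<exists>p. awalk x p y \<and> length p \<le> n)"
    using assms(3) unfolding graph_dist_le_iff[OF assms(1)] .
  then show "ereal (real (Suc n)) \<le> graph_dist G x y"
    unfolding graph_dist_def \<mu>_def
    by (intro INF_greatest) (auto simp: awalk_cost_def sum_list_triv)
qed fact

section \<open>Simple graphs\<close>

lemma simple_graph_cong:
  assumes "V = W"
    and "\<And>x y. x \<in> W \<Longrightarrow> y \<in> W \<Longrightarrow> x \<noteq> y \<Longrightarrow> P x y \<longleftrightarrow> Q x y"
  shows "simple_graph V P = simple_graph W Q"
proof -
  have "{(x, y). x \<in> V \<and> y \<in> V \<and> x \<noteq> y \<and> P x y} = {(x, y). x \<in> W \<and> y \<in> W \<and> x \<noteq> y \<and> Q x y}"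
    using assms by blast
  then show ?thesis using assms(1) by (simp add: simple_graph_def)
qed

lemma induce_simple_graph:
  assumes "W \<subseteq> V"
  shows "simple_graph V P \<restriction> W = simple_graph W P"
  using assms by (auto simp: simple_graph_def with_proj_def induce_subgraph_def)

lemma is_disjoint_union_simple_graphI:
  assumes "V = V1 \<union> V2" "V1 \<inter> V2 = {}"
    and "\<And>x y. x \<in> V1 \<Longrightarrow> y \<in> V1 \<Longrightarrow> x \<noteq> y \<Longrightarrow> P x y \<longleftrightarrow> P1 x y"
    and "\<And>x y. x \<in> V2 \<Longrightarrow> y \<in> V2 \<Longrightarrow> x \<noteq> y \<Longrightarrow> P x y \<longleftrightarrow> P2 x y"
    and "\<And>x y. x \<in> V1 \<Longrightarrow> y \<in> V2 \<Longrightarrow> \<not> P x y \<and> \<not> P y x"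
  shows "is_disjoint_union (simple_graph V P) (simple_graph V1 P1) (simple_graph V2 P2)"
  using assms(1,2) assms(3-5)
  unfolding is_disjoint_union_def simple_graph_def with_proj_def union_def by fastforce

lemma digraph_iso_refl:
  assumes "wf_digraph G"
  shows "digraph_iso G G"
  unfolding digraph_iso_def
  by (rule exI[of _ "\<lparr>iso_verts = id, iso_arcs = id, iso_head = head G, iso_tail = tail G\<rparr>"])
    (simp add: pre_digraph.digraph_isomorphism_def app_iso_def assms)

lemma MMD_commute: "MMD G x y \<longleftrightarrow> MMD G y x"
  by (auto simp: MMD_def)

section \<open>The clean graph of a ring with a nontrivial idempotent\<close>

lemma Units'_iff:
  assumes "cring R"
  shows "u \<in> Units' R \<longleftrightarrow> u \<in> Units R \<and> u \<otimes>\<^bsub>R\<^esub> u = \<one>\<^bsub>R\<^esub>"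
proof -
  interpret cring R by fact
  show ?thesis by (auto simp: Units'_def numeral_2_eq_2)
qed

locale nontrivial_idempotent_cring = cring +
  assumes ex_nontrivial_idempotent: "\<exists>e \<in> idempotents R. e \<noteq> \<zero> \<and> e \<noteq> \<one>"
begin

section \<open>Idempotents and their complements\<close>

lemma one_neq_zero: "\<one> \<noteq> \<zero>"
  using ex_nontrivial_idempotent one_zeroD by (auto simp: idempotents_def)

lemma one_idempotent: "\<one> \<in> idempotents R"
  by (simp add: idempotents_def)

lemma idempotent_closed: "e \<in> idempotents R \<Longrightarrow> e \<in> carrier R"
  and idempotent_square: "e \<in> idempotents R \<Longrightarrow> e \<otimes> e = e"
  by (simp_all add: idempotents_def)

lemma mult_complement_eq:
  assumes "e \<in> carrier R" "f \<in> carrier R"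
  shows "f \<otimes> (\<one> \<ominus> e) = f \<ominus> f \<otimes> e"
  using assms by (simp add: a_minus_def r_distr r_minus)

text \<open>For idempotents the right-hand side is the order relation f \<le> e; its antisymmetry
  later yields \<open>e = f\<close>.\<close>

lemma mult_complement_eq_zero_iff:
  assumes "e \<in> carrier R" "f \<in> carrier R"
  shows "f \<otimes> (\<one> \<ominus> e) = \<zero> \<longleftrightarrow> f \<otimes> e = f"
  using assms by (auto simp: mult_complement_eq)

lemma complement_idempotent:
  assumes "e \<in> idempotents R"
  shows "\<one> \<ominus> e \<in> idempotents R" "e \<otimes> (\<one> \<ominus> e) = \<zero>"
proof -
  have e: "e \<in> carrier R" "e \<otimes> e = e" using assms by (auto simp: idempotents_def)
  then show orth: "e \<otimes> (\<one> \<ominus> e) = \<zero>" by (simp add: mult_complement_eq_zero_iff)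
  then have "(\<one> \<ominus> e) \<otimes> e = \<zero>" using e m_comm[of e "\<one> \<ominus> e"] by simp
  then have "(\<one> \<ominus> e) \<otimes> (\<one> \<ominus> e) = \<one> \<ominus> e"
    using e by (simp add: mult_complement_eq) (simp add: a_minus_def)
  then show "\<one> \<ominus> e \<in> idempotents R" using e by (simp add: idempotents_def)
qed

lemma complement_eq_zero_iff:
  assumes "e \<in> idempotents R"
  shows "\<one> \<ominus> e = \<zero> \<longleftrightarrow> e = \<one>"
  using assms by (auto simp: idempotents_def)

lemma complement_eq_one_iff:
  assumes "e \<in> idempotents R"
  shows "\<one> \<ominus> e = \<one> \<longleftrightarrow> e = \<zero>"
  using complement_idempotent(2)[OF assms] assms
  by (auto simp: idempotents_def a_minus_def)

lemma Units_mult_eq_one_iff: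
  assumes "u \<in> Units R" "v \<in> Units R"
  shows "u \<otimes> v = \<one> \<longleftrightarrow> v = inv u"
  using assms by (metis Units_closed Units_r_inv comm_inv_char m_comm)

section \<open>Adjacency in the clean graph\<close>

lemma Cl2_eq:
  "Cl2 R = simple_graph ((idempotents R - {\<zero>}) \<times> Units R)
     (\<lambda>(e, u) (f, v). e \<otimes> f = \<zero> \<or> u \<otimes> v = \<one>)"
proof -
  have "{(e, u) \<in> verts (Cl R). e \<noteq> \<zero>} = (idempotents R - {\<zero>}) \<times> Units R"
    by (auto simp: Cl_def)
  then show ?thesis
    by (simp add: Cl2_def) (subst Cl_def, rule induce_simple_graph, auto)
qed

lemma verts_Cl2: "verts (Cl2 R) = (idempotents R - {\<zero>}) \<times> Units R"
  by (simp add: Cl2_eq)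

lemma wf_Cl2: "wf_digraph (Cl2 R)"
  by (simp add: Cl2_eq wf_digraph_simple_graph)

lemma Cl2_dominates_iff:
  "(e, u) \<rightarrow>\<^bsub>Cl2 R\<^esub> (f, v) \<longleftrightarrow> (e, u) \<in> verts (Cl2 R) \<and> (f, v) \<in> verts (Cl2 R) \<and>
     (e, u) \<noteq> (f, v) \<and> (e \<otimes> f = \<zero> \<or> u \<otimes> v = \<one>)"
  unfolding verts_Cl2 unfolding Cl2_eq by auto

lemma Cl2_dominates_sym: "x \<rightarrow>\<^bsub>Cl2 R\<^esub> y \<Longrightarrow> y \<rightarrow>\<^bsub>Cl2 R\<^esub> x"
  by (cases x; cases y) (auto simp: Cl2_dominates_iff verts_Cl2 m_comm idempotent_closed Units_closed)

lemma Cl2_dominatesD: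
  "x \<rightarrow>\<^bsub>Cl2 R\<^esub> y \<Longrightarrow> x \<in> verts (Cl2 R) \<and> y \<in> verts (Cl2 R) \<and> x \<noteq> y"
  by (cases x; cases y) (auto simp: Cl2_dominates_iff)

text \<open>Orthogonality of \<open>e\<close> and its complement leaves the unit \<open>w\<close>
  free. The two vertices are distinct because \<open>e = \<one> \<ominus> e\<close> would give e = e
  \<otimes> e = 0.\<close>

lemma Cl2_dominates_complement:
  assumes "(e, u) \<in> verts (Cl2 R)" "e \<noteq> \<one>" "w \<in> Units R"
  shows "(e, u) \<rightarrow>\<^bsub>Cl2 R\<^esub> (\<one> \<ominus> e, w)"
  using assms complement_idempotent[of e] idempotent_square[of e]
  by (auto simp: Cl2_dominates_iff verts_Cl2 complement_eq_zero_iff)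

lemma Cl2_dominates_inv:
  assumes "(e, u) \<in> verts (Cl2 R)" "f \<in> idempotents R" "f \<noteq> \<zero>" "f \<noteq> e"
  shows "(e, u) \<rightarrow>\<^bsub>Cl2 R\<^esub> (f, inv u)"
  using assms by (auto simp: Cl2_dominates_iff verts_Cl2)

section \<open>Distances in the clean graph\<close>

definition Cl2_dist :: "'a \<times> 'a \<Rightarrow> 'a \<times> 'a \<Rightarrow> nat" where
  "Cl2_dist x y =
    (if x = y then 0 else if x \<rightarrow>\<^bsub>Cl2 R\<^esub> y then 1
     else if fst x = \<one> \<and> fst y = \<one> then 3 else 2)"

lemma graph_dist_Cl2_le_1_iff:
  "graph_dist (Cl2 R) x y \<le> ereal (real (Suc 0)) \<longleftrightarrow>
     x = y \<and> x \<in> verts (Cl2 R) \<or> x \<rightarrow>\<^bsub>Cl2 R\<^esub> y"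
  unfolding graph_dist_le_Suc_iff[OF wf_Cl2] graph_dist_le_0_iff[OF wf_Cl2]
  using Cl2_dominatesD by blast

lemma graph_dist_Cl2_le_2_iff:
  "graph_dist (Cl2 R) x y \<le> ereal (real (Suc (Suc 0))) \<longleftrightarrow>
     x = y \<and> x \<in> verts (Cl2 R) \<or> x \<rightarrow>\<^bsub>Cl2 R\<^esub> y \<or> (\<exists>z. x \<rightarrow>\<^bsub>Cl2 R\<^esub> z \<and> z \<rightarrow>\<^bsub>Cl2 R\<^esub> y)"
  unfolding graph_dist_le_Suc_iff[OF wf_Cl2, of _ _ "Suc 0"] graph_dist_Cl2_le_1_iff
  using Cl2_dominatesD by blast

text \<open>The vertex \<open>(\<one> \<ominus> e, inv v)\<close> is joined to \<open>(e, u)\<close>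
  through the idempotents and to \<open>(f, v)\<close> through the units.\<close>

lemma Cl2_common_neighbour:
  assumes "(e, u) \<in> verts (Cl2 R)" "(f, v) \<in> verts (Cl2 R)" "e \<noteq> \<one>"
    and "(e, u) \<noteq> (f, v)" "\<not> (e, u) \<rightarrow>\<^bsub>Cl2 R\<^esub> (f, v)"
  shows "\<exists>z. (e, u) \<rightarrow>\<^bsub>Cl2 R\<^esub> z \<and> z \<rightarrow>\<^bsub>Cl2 R\<^esub> (f, v)"
proof (intro exI conjI)
  show "(e, u) \<rightarrow>\<^bsub>Cl2 R\<^esub> (\<one> \<ominus> e, inv v)"
    using assms by (intro Cl2_dominates_complement) (auto simp: verts_Cl2)
  have "f \<noteq> \<one> \<ominus> e"
    using assms complement_idempotent(2)[of e] by (auto simp: Cl2_dominates_iff verts_Cl2)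
  then have "(f, v) \<rightarrow>\<^bsub>Cl2 R\<^esub> (\<one> \<ominus> e, inv v)"
    using assms complement_idempotent(1)[of e]
    by (intro Cl2_dominates_inv) (auto simp: verts_Cl2 complement_eq_zero_iff)
  then show "(\<one> \<ominus> e, inv v) \<rightarrow>\<^bsub>Cl2 R\<^esub> (f, v)" by (rule Cl2_dominates_sym)
qed

text \<open>Since \<open>\<one> \<otimes> g = g\<close> is nonzero, a common neighbour
  \<open>(g, w)\<close> is joined to both vertices through the units, which forces
  \<open>u = inv w = v\<close>.\<close>

lemma Cl2_no_common_neighbour:
  assumes "(\<one>, u) \<noteq> (\<one>, v)"
    and "\<not> (\<one>, u) \<rightarrow>\<^bsub>Cl2 R\<^esub> (\<one>, v)"
  shows "\<not> ((\<one>, u) \<rightarrow>\<^bsub>Cl2 R\<^esub> z \<and> z \<rightarrow>\<^bsub>Cl2 R\<^esub> (\<one>, v))"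
proof
  assume z: "(\<one>, u) \<rightarrow>\<^bsub>Cl2 R\<^esub> z \<and> z \<rightarrow>\<^bsub>Cl2 R\<^esub> (\<one>, v)"
  obtain g w where "z = (g, w)" by (cases z)
  then have "g \<in> carrier R" "g \<noteq> \<zero>" "u \<in> Units R" "v \<in> Units R" "w \<in> Units R"
    "u \<otimes> w = \<one>" "w \<otimes> v = \<one>"
    using z by (auto simp: Cl2_dominates_iff verts_Cl2 idempotent_closed)
  then have "w = inv u" "v = inv w" by (simp_all add: Units_mult_eq_one_iff)
  with \<open>u \<in> Units R\<close> assms(1) show False by simp
qed

lemma graph_dist_Cl2:
  assumes x: "x \<in> verts (Cl2 R)" and y: "y \<in> verts (Cl2 R)"
  shows "graph_dist (Cl2 R) x y = ereal (real (Cl2_dist x y))"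
proof -
  obtain e u f v where [simp]: "x = (e, u)" "y = (f, v)" by (cases x; cases y)
  consider "x = y" | "x \<noteq> y" "x \<rightarrow>\<^bsub>Cl2 R\<^esub> y"
    | "x \<noteq> y" "\<not> x \<rightarrow>\<^bsub>Cl2 R\<^esub> y" "e \<noteq> \<one> \<or> f \<noteq> \<one>"
    | "x \<noteq> y" "\<not> x \<rightarrow>\<^bsub>Cl2 R\<^esub> y" "e = \<one>" "f = \<one>"
    by blast
  then show ?thesis
  proof cases
    case 1
    then show ?thesis using graph_dist_eq_0[OF wf_Cl2 y] by (simp add: Cl2_dist_def)
  next
    case 2
    then have "graph_dist (Cl2 R) x y = ereal (real (Suc 0))"
      by (intro graph_dist_eq_SucI[OF wf_Cl2])
        (simp_all only: graph_dist_Cl2_le_1_iff graph_dist_le_0_iff[OF wf_Cl2] simp_thms)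
    then show ?thesis using 2 by (simp add: Cl2_dist_def)
  next
    case 3
    have "\<exists>z. x \<rightarrow>\<^bsub>Cl2 R\<^esub> z \<and> z \<rightarrow>\<^bsub>Cl2 R\<^esub> y"
    proof (cases "e = \<one>")
      case True
      \<comment> \<open>\<open>Cl2_common_neighbour\<close> needs its first idempotent to differ
        from 1, so here the two vertices are swapped.\<close>
      have "\<not> (f, v) \<rightarrow>\<^bsub>Cl2 R\<^esub> (e, u)" using 3 Cl2_dominates_sym by auto
      then obtain z where "(f, v) \<rightarrow>\<^bsub>Cl2 R\<^esub> z" "z \<rightarrow>\<^bsub>Cl2 R\<^esub> (e, u)"
        using Cl2_common_neighbour[of f v e u] 3 True x y by auto
      then show ?thesis using Cl2_dominates_sym by fastforce
    next
      case False
      with 3 Cl2_common_neighbour[of e u f v] x y show ?thesis by auto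
    qed
    then have "graph_dist (Cl2 R) x y = ereal (real (Suc (Suc 0)))"
      using 3 by (intro graph_dist_eq_SucI[OF wf_Cl2])
        (simp_all only: graph_dist_Cl2_le_1_iff graph_dist_Cl2_le_2_iff simp_thms)
    then show ?thesis using 3 by (auto simp: Cl2_dist_def)
  next
    case 4
    obtain g where g: "g \<in> idempotents R" "g \<noteq> \<zero>" "g \<noteq> \<one>"
      using ex_nontrivial_idempotent by blast
    have units: "u \<in> Units R" "v \<in> Units R" using x y by (auto simp: verts_Cl2)
    \<comment> \<open>A walk of length 3 runs from \<open>(\<one>, u)\<close> through
      \<open>(g, inv u)\<close> and \<open>(\<one> \<ominus> g, inv v)\<close> to
      \<open>(\<one>, v)\<close>; its middle arc comes from orthogonality, the outer ones from the
      units.\<close>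
    have xz: "x \<rightarrow>\<^bsub>Cl2 R\<^esub> (g, inv u)"
      using x g 4 by (auto intro: Cl2_dominates_inv)
    have "\<one> \<ominus> g \<noteq> \<one>" "\<one> \<ominus> g \<noteq> \<zero>"
      using g by (simp_all add: complement_eq_one_iff complement_eq_zero_iff)
    then have "y \<rightarrow>\<^bsub>Cl2 R\<^esub> (\<one> \<ominus> g, inv v)"
      using y g 4 by (auto intro: Cl2_dominates_inv complement_idempotent(1))
    then have "(\<one> \<ominus> g, inv v) \<rightarrow>\<^bsub>Cl2 R\<^esub> y" by (rule Cl2_dominates_sym)
    moreover have "(g, inv u) \<rightarrow>\<^bsub>Cl2 R\<^esub> (\<one> \<ominus> g, inv v)"
      using g units by (intro Cl2_dominates_complement) (auto simp: verts_Cl2)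
    ultimately have "graph_dist (Cl2 R) (g, inv u) y \<le> ereal (real (Suc (Suc 0)))"
      unfolding graph_dist_Cl2_le_2_iff by blast
    with xz have "graph_dist (Cl2 R) x y \<le> ereal (real (Suc (Suc (Suc 0))))"
      unfolding graph_dist_le_Suc_iff[OF wf_Cl2, of _ _ "Suc (Suc 0)"] by blast
    moreover have "\<not> graph_dist (Cl2 R) x y \<le> ereal (real (Suc (Suc 0)))"
      unfolding graph_dist_Cl2_le_2_iff using 4 Cl2_no_common_neighbour[of u v] by auto
    ultimately have "graph_dist (Cl2 R) x y = ereal (real (Suc (Suc (Suc 0))))"
      by (rule graph_dist_eq_SucI[OF wf_Cl2])
    then show ?thesis using 4 by (auto simp: Cl2_dist_def)
  qed
qed

lemma maximally_distant_Cl2_iff: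
  assumes "x \<in> verts (Cl2 R)" "y \<in> verts (Cl2 R)"
  shows "maximally_distant (Cl2 R) x y \<longleftrightarrow>
    (\<forall>w. x \<rightarrow>\<^bsub>Cl2 R\<^esub> w \<longrightarrow> Cl2_dist y w \<le> Cl2_dist x y)"
  unfolding maximally_distant_def
  using assms Cl2_dominatesD by (fastforce simp: graph_dist_Cl2)

section \<open>Completeness and adjacent vertices\<close>

lemma is_complete_Cl2_iff: "is_complete (Cl2 R) \<longleftrightarrow> Units R = {\<one>}"
proof
  assume complete: "is_complete (Cl2 R)"
  obtain g where g: "g \<in> idempotents R" "g \<noteq> \<zero>" "g \<noteq> \<one>"
    using ex_nontrivial_idempotent by blast
  have "u = \<one>" if "u \<in> Units R" for u
  proof -
    \<comment> \<open>The product of the idempotents is \<open>g\<close>, which is nonzero, so this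
      arc can only come from \<open>u \<otimes> \<one> = \<one>\<close>.\<close>
    have "(\<one>, u) \<rightarrow>\<^bsub>Cl2 R\<^esub> (g, \<one>)"
      using complete g that one_neq_zero one_idempotent
      unfolding is_complete_def by (auto simp: verts_Cl2)
    then show ?thesis using g that by (auto simp: Cl2_dominates_iff idempotent_closed)
  qed
  then show "Units R = {\<one>}" by auto
next
  assume "Units R = {\<one>}"
  then show "is_complete (Cl2 R)"
    by (auto simp: is_complete_def verts_Cl2 Cl2_dominates_iff)
qed

text \<open>Adjacent vertices are at distance 1, so maximal distance keeps every neighbour of
  \<open>x\<close> within distance 1 of \<open>y\<close>. With \<open>MMD_commute\<close> this makes
  the closed neighbourhoods equal.\<close>

lemma MMD_adjacentD:
  assumes "MMD (Cl2 R) x y" "x \<rightarrow>\<^bsub>Cl2 R\<^esub> y" "x \<rightarrow>\<^bsub>Cl2 R\<^esub> w"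
  shows "y = w \<or> y \<rightarrow>\<^bsub>Cl2 R\<^esub> w"
proof -
  have "x \<in> verts (Cl2 R)" "y \<in> verts (Cl2 R)" "x \<noteq> y"
    using assms(2) Cl2_dominatesD by blast+
  then have "Cl2_dist y w \<le> 1"
    using assms by (cases w) (auto simp: MMD_def maximally_distant_Cl2_iff Cl2_dist_def[of x y])
  then show ?thesis by (auto simp: Cl2_dist_def split: if_splits)
qed

lemma ex_other_unit:
  assumes "\<not> is_complete (Cl2 R)"
  obtains w where "w \<in> Units R" "w \<noteq> u"
  using assms unfolding is_complete_Cl2_iff by blast

lemma MMD_adjacent_idempotent_neq_one:
  assumes "\<not> is_complete (Cl2 R)" "(e, u) \<rightarrow>\<^bsub>Cl2 R\<^esub> (f, v)" "MMD (Cl2 R) (e, u) (f, v)"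
  shows "e \<noteq> \<one>"
proof
  assume e: "e = \<one>"
  have mem: "(e, u) \<in> verts (Cl2 R)" "(f, v) \<in> verts (Cl2 R)" "(e, u) \<noteq> (f, v)"
    using assms(2) Cl2_dominatesD by blast+
  then have units: "u \<in> Units R" "v \<in> Units R" and f: "f \<in> idempotents R" "f \<noteq> \<zero>"
    by (auto simp: verts_Cl2)
  then have v: "v = inv u"
    using assms(2) e by (auto simp: Cl2_dominates_iff idempotent_closed Units_mult_eq_one_iff)
  show False
  proof (cases "f = \<one>")
    case True
    obtain g where g: "g \<in> idempotents R" "g \<noteq> \<zero>" "g \<noteq> \<one>"
      using ex_nontrivial_idempotent by blast
    \<comment> \<open>This neighbour of \<open>(\<one>, u)\<close> must also be joined to
      \<open>(\<one>, v)\<close>, and only the units can do that; then \<open>u = v\<close>, so the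
      two vertices coincide.\<close>
    then have "(e, u) \<rightarrow>\<^bsub>Cl2 R\<^esub> (g, inv u)"
      using mem e by (auto intro: Cl2_dominates_inv)
    then have "(f, v) \<rightarrow>\<^bsub>Cl2 R\<^esub> (g, inv u)"
      using MMD_adjacentD assms(2,3) g True by blast
    then have "v \<otimes> inv u = \<one>"
      using True g by (auto simp: Cl2_dominates_iff idempotent_closed)
    then have "inv u = inv v" using units by (simp add: Units_mult_eq_one_iff)
    then show False using mem(3) e True units Units_inv_inv by metis
  next
    case False
    \<comment> \<open>This choice of \<open>w\<close> separates the neighbourhoods:
      \<open>(\<one> \<ominus> f, w)\<close> is joined to \<open>(f, v)\<close>, but not to
      \<open>(\<one>, u)\<close>, since \<open>\<one> \<ominus> f\<close> is nonzero and
      \<open>u \<otimes> w\<close> is not 1.\<close>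
    obtain w where w: "w \<in> Units R" "w \<noteq> inv u" using ex_other_unit assms(1) by blast
    have "(f, v) \<rightarrow>\<^bsub>Cl2 R\<^esub> (\<one> \<ominus> f, w)"
      using mem w False by (intro Cl2_dominates_complement)
    then have "(e, u) = (\<one> \<ominus> f, w) \<or> (e, u) \<rightarrow>\<^bsub>Cl2 R\<^esub> (\<one> \<ominus> f, w)"
      using MMD_adjacentD[of "(f, v)" "(e, u)"] assms(2,3) Cl2_dominates_sym MMD_commute by metis
    moreover have "\<one> \<ominus> f \<noteq> \<one>" "\<one> \<ominus> f \<noteq> \<zero>" "\<one> \<ominus> f \<in> carrier R"
      using f False
      by (simp_all add: complement_eq_one_iff complement_eq_zero_iff idempotent_closed)
    ultimately show False
      using e w units by (auto simp: Cl2_dominates_iff Units_mult_eq_one_iff)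
  qed
qed

text \<open>Equality of closed neighbourhoods is tested twice: the neighbour
  \<open>(\<one>, inv u)\<close> forces \<open>v = u\<close>, and the complements of
  \<open>e\<close> and \<open>f\<close>, paired with a suitable unit, force each idempotent below
  the other.\<close>

lemma not_MMD_adjacent:
  assumes "\<not> is_complete (Cl2 R)" "(e, u) \<rightarrow>\<^bsub>Cl2 R\<^esub> (f, v)"
  shows "\<not> MMD (Cl2 R) (e, u) (f, v)"
proof
  assume mmd: "MMD (Cl2 R) (e, u) (f, v)"
  have adj': "(f, v) \<rightarrow>\<^bsub>Cl2 R\<^esub> (e, u)" using assms(2) by (rule Cl2_dominates_sym)
  have mmd': "MMD (Cl2 R) (f, v) (e, u)" using mmd MMD_commute by metis
  have ne1: "e \<noteq> \<one>" "f \<noteq> \<one>"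
    using MMD_adjacent_idempotent_neq_one assms mmd adj' mmd' by blast+
  have mem: "(e, u) \<in> verts (Cl2 R)" "(f, v) \<in> verts (Cl2 R)" "(e, u) \<noteq> (f, v)"
    using assms(2) Cl2_dominatesD by blast+
  then have units: "u \<in> Units R" "v \<in> Units R"
    and ef: "e \<in> idempotents R" "e \<noteq> \<zero>" "f \<in> idempotents R" "f \<noteq> \<zero>"
    by (auto simp: verts_Cl2)
  have "(e, u) \<rightarrow>\<^bsub>Cl2 R\<^esub> (\<one>, inv u)"
    using mem ne1 one_idempotent one_neq_zero by (auto intro: Cl2_dominates_inv)
  then have "(f, v) \<rightarrow>\<^bsub>Cl2 R\<^esub> (\<one>, inv u)"
    using MMD_adjacentD assms(2) mmd ne1 by blast
  then have "v \<otimes> inv u = \<one>"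
    using ef by (auto simp: Cl2_dominates_iff idempotent_closed)
  then have "inv u = inv v" using units by (simp add: Units_mult_eq_one_iff)
  then have vu: "v = u" using units Units_inv_inv by metis
  then have "e \<noteq> f" using mem by auto
  have compl: "(f, u) = (\<one> \<ominus> e, w) \<or> f \<otimes> e = f"
    if "w \<in> Units R" "w \<noteq> inv u" for w
  proof -
    have "(e, u) \<rightarrow>\<^bsub>Cl2 R\<^esub> (\<one> \<ominus> e, w)"
      using mem that ne1 by (intro Cl2_dominates_complement)
    then have "(f, v) = (\<one> \<ominus> e, w) \<or> (f, v) \<rightarrow>\<^bsub>Cl2 R\<^esub> (\<one> \<ominus> e, w)"
      using MMD_adjacentD assms(2) mmd by blast
    then show ?thesis
      using that units vu ef
      by (auto simp: Cl2_dominates_iff Units_mult_eq_one_iff idempotent_closed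
          mult_complement_eq_zero_iff)
  qed
  have compl': "(e, u) = (\<one> \<ominus> f, w) \<or> e \<otimes> f = e"
    if "w \<in> Units R" "w \<noteq> inv u" for w
  proof -
    have "(f, v) \<rightarrow>\<^bsub>Cl2 R\<^esub> (\<one> \<ominus> f, w)"
      using mem that ne1 by (intro Cl2_dominates_complement)
    then have "(e, u) = (\<one> \<ominus> f, w) \<or> (e, u) \<rightarrow>\<^bsub>Cl2 R\<^esub> (\<one> \<ominus> f, w)"
      using MMD_adjacentD adj' mmd' by blast
    then show ?thesis
      using that units vu ef
      by (auto simp: Cl2_dominates_iff Units_mult_eq_one_iff idempotent_closed
          mult_complement_eq_zero_iff)
  qed
  \<comment> \<open>The condition \<open>w \<noteq> inv u\<close> rules out adjacency through the
    units, \<open>w \<noteq> u\<close> the coincidence of vertices in \<open>compl\<close> and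
    \<open>compl'\<close>. If \<open>u\<close> is not its own inverse, \<open>\<one>\<close> serves,
    being its own inverse.\<close>
  have "\<exists>w \<in> Units R. w \<noteq> inv u \<and> w \<noteq> u"
  proof (cases "u = inv u")
    case True
    then show ?thesis using ex_other_unit[OF assms(1)] by metis
  next
    case False
    then have "\<one> \<noteq> u" by auto
    moreover have "\<one> \<noteq> inv u" using \<open>\<one> \<noteq> u\<close> units by (metis Units_inv_inv inv_one)
    ultimately show ?thesis by blast
  qed
  then obtain w where "w \<in> Units R" "w \<noteq> inv u" "w \<noteq> u" by blast
  then have "f \<otimes> e = f" "e \<otimes> f = e" using compl compl' by blast+
  then show False using \<open>e \<noteq> f\<close> ef by (metis idempotent_closed m_comm)
qed

section \<open>Mutually maximally distant pairs\<close>

lemma MMD_one_iff: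
  assumes "(\<one>, u) \<in> verts (Cl2 R)" "(f, v) \<in> verts (Cl2 R)" "f \<noteq> \<one>"
    and "\<not> (\<one>, u) \<rightarrow>\<^bsub>Cl2 R\<^esub> (f, v)"
  shows "MMD (Cl2 R) (\<one>, u) (f, v) \<longleftrightarrow> u = v"
proof -
  have units: "u \<in> Units R" "v \<in> Units R" and f: "f \<in> idempotents R" "f \<noteq> \<zero>"
    using assms by (auto simp: verts_Cl2)
  have uv: "u \<otimes> v \<noteq> \<one>" using assms by (auto simp: Cl2_dominates_iff)
  then have uv': "u \<noteq> inv v" using units by auto
  have nadj': "\<not> (f, v) \<rightarrow>\<^bsub>Cl2 R\<^esub> (\<one>, u)" using assms(4) Cl2_dominates_sym by blast
  have dist: "Cl2_dist (\<one>, u) (f, v) = 2" "Cl2_dist (f, v) (\<one>, u) = 2"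
    using assms nadj' by (auto simp: Cl2_dist_def)
  \<comment> \<open>Distance 3 requires idempotent 1 at both ends, so in this direction maximal
    distance holds whatever the units are.\<close>
  have "Cl2_dist (f, v) w \<le> 2" for w using assms(3) by (simp add: Cl2_dist_def)
  then have "maximally_distant (Cl2 R) (\<one>, u) (f, v)"
    using assms by (simp add: maximally_distant_Cl2_iff dist)
  moreover have "maximally_distant (Cl2 R) (f, v) (\<one>, u) \<longleftrightarrow> u = v"
  proof -
    have "maximally_distant (Cl2 R) (f, v) (\<one>, u) \<longleftrightarrow>
        (\<forall>g w. (f, v) \<rightarrow>\<^bsub>Cl2 R\<^esub> (g, w) \<longrightarrow> Cl2_dist (\<one>, u) (g, w) \<le> 2)"
      using assms by (simp add: maximally_distant_Cl2_iff dist)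
    \<comment> \<open>Only a neighbour of \<open>(f, v)\<close> with idempotent 1 could be at
      distance 3 from \<open>(\<one>, u)\<close>; as \<open>f\<close> is nonzero,
      \<open>(\<one>, inv v)\<close> is the only one.\<close>
    also have "\<dots> \<longleftrightarrow> (\<forall>w. (f, v) \<rightarrow>\<^bsub>Cl2 R\<^esub> (\<one>, w) \<longrightarrow> Cl2_dist (\<one>, u) (\<one>, w) \<le> 2)"
      by (auto simp: Cl2_dist_def)
    also have "\<dots> \<longleftrightarrow> Cl2_dist (\<one>, u) (\<one>, inv v) \<le> 2"
    proof -
      have "(f, v) \<rightarrow>\<^bsub>Cl2 R\<^esub> (\<one>, w) \<longleftrightarrow> w = inv v" for w
        using assms f units one_idempotent one_neq_zero
        by (auto simp: Cl2_dominates_iff verts_Cl2 Units_mult_eq_one_iff idempotent_closed)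
      then show ?thesis by simp
    qed
    \<comment> \<open>Between vertices with idempotent 1 the value 2 does not occur, so the bound
      means equality or adjacency, and \<open>uv'\<close> excludes equality.\<close>
    also have "\<dots> \<longleftrightarrow> (\<one>, u) \<rightarrow>\<^bsub>Cl2 R\<^esub> (\<one>, inv v)"
      using uv' by (simp add: Cl2_dist_def)
    also have "\<dots> \<longleftrightarrow> u = v"
    proof -
      have "u \<otimes> inv v = \<one> \<longleftrightarrow> u = v"
        using units by (metis Units_mult_eq_one_iff Units_inv_Units Units_inv_inv)
      then show ?thesis
        using assms(1) uv' units one_neq_zero by (auto simp: Cl2_dominates_iff verts_Cl2)
    qed
    finally show ?thesis .
  qed
  ultimately show ?thesis by (simp add: MMD_def)
qed

lemma Units''_iff: "u \<in> Units'' R \<longleftrightarrow> u \<in> Units R \<and> u \<otimes> u \<noteq> \<one>"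
  by (auto simp: Units''_def Units'_iff[OF is_cring])

lemma MMD_Cl2_iff:
  assumes "\<not> is_complete (Cl2 R)"
    and x: "(e, u) \<in> verts (Cl2 R)" and y: "(f, v) \<in> verts (Cl2 R)" and "(e, u) \<noteq> (f, v)"
  shows "MMD (Cl2 R) (e, u) (f, v) \<longleftrightarrow>
      (e = \<one> \<and> f = \<one> \<and> u \<otimes> v \<noteq> \<one>)
    \<or> (e \<noteq> \<one> \<and> f \<noteq> \<one> \<and> e \<otimes> f \<noteq> \<zero> \<and> u \<otimes> v \<noteq> \<one>)
    \<or> ((e = \<one>) \<noteq> (f = \<one>) \<and> u = v \<and> u \<in> Units'' R)" (is "_ \<longleftrightarrow> ?H")
proof -
  have mem: "u \<in> Units R" "v \<in> Units R" "e \<in> idempotents R" "e \<noteq> \<zero>" "f \<in> idempotents R" "f \<noteq> \<zero>"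
    using x y by (auto simp: verts_Cl2)
  have adj: "(e, u) \<rightarrow>\<^bsub>Cl2 R\<^esub> (f, v) \<longleftrightarrow> e \<otimes> f = \<zero> \<or> u \<otimes> v = \<one>"
    using assms by (auto simp: Cl2_dominates_iff)
  have adj': "(f, v) \<rightarrow>\<^bsub>Cl2 R\<^esub> (e, u) \<longleftrightarrow> e \<otimes> f = \<zero> \<or> u \<otimes> v = \<one>"
    using adj Cl2_dominates_sym by blast
  show ?thesis
  proof (cases "(e, u) \<rightarrow>\<^bsub>Cl2 R\<^esub> (f, v)")
    case True
    \<comment> \<open>Every clause of \<open>?H\<close> entails non-adjacency; in the third, the
      product of the idempotents is the one different from 1, hence nonzero, and
      \<open>u \<otimes> u\<close> is not 1.\<close>
    then have "\<not> ?H"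
      using adj mem by (auto simp: Units''_iff idempotent_closed)
    then show ?thesis using True assms(1) not_MMD_adjacent by blast
  next
    case False
    then have nz: "e \<otimes> f \<noteq> \<zero>" "u \<otimes> v \<noteq> \<one>" and False': "\<not> (f, v) \<rightarrow>\<^bsub>Cl2 R\<^esub> (e, u)"
      using adj adj' by auto
    consider "e = \<one>" "f = \<one>" | "e \<noteq> \<one>" "f \<noteq> \<one>" | "e = \<one>" "f \<noteq> \<one>" | "e \<noteq> \<one>" "f = \<one>"
      by blast
    then show ?thesis
    proof cases
      case 1
      then have "Cl2_dist (e, u) (f, v) = 3" "Cl2_dist (f, v) (e, u) = 3"
        using False False' assms(4) by (auto simp: Cl2_dist_def)
      \<comment> \<open>3 is the largest value of \<open>Cl2_dist\<close>.\<close>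
      then have "MMD (Cl2 R) (e, u) (f, v)"
        using x y by (auto simp: MMD_def maximally_distant_Cl2_iff) (auto simp: Cl2_dist_def)
      then show ?thesis using 1 nz by simp
    next
      case 2
      then have "Cl2_dist (e, u) (f, v) = 2" "Cl2_dist (f, v) (e, u) = 2"
        using False False' assms(4) by (auto simp: Cl2_dist_def)
      \<comment> \<open>From a vertex whose idempotent is not 1, no vertex is farther away than
        2.\<close>
      then have "MMD (Cl2 R) (e, u) (f, v)"
        using x y 2 by (auto simp: MMD_def maximally_distant_Cl2_iff) (auto simp: Cl2_dist_def)
      then show ?thesis using 2 nz by simp
    next
      case 3
      then show ?thesis
        using MMD_one_iff[of u f v] x y False nz mem by (auto simp: Units''_iff)
    next
      case 4
      then show ?thesis
        using MMD_one_iff[of v e u] MMD_commute[of "Cl2 R" "(e, u)"] x y False' nz mem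
        by (auto simp: Units''_iff)
    qed
  qed
qed

section \<open>The strong resolving graph\<close>

lemma ex_MMD_Cl2:
  assumes "x \<in> verts (Cl2 R)"
  shows "\<exists>y \<in> verts (Cl2 R). MMD (Cl2 R) x y"
proof -
  obtain e u where x: "x = (e, u)" by (cases x)
  then have mem: "e \<in> idempotents R" "e \<noteq> \<zero>" "u \<in> Units R" using assms by (auto simp: verts_Cl2)
  \<comment> \<open>\<open>g\<close> is a nontrivial idempotent if \<open>e = \<one>\<close>, and
    \<open>\<one>\<close> otherwise.\<close>
  obtain g where g: "g \<in> idempotents R" "g \<noteq> \<zero>" "(e = \<one>) \<noteq> (g = \<one>)"
    using ex_nontrivial_idempotent one_idempotent one_neq_zero by blast
  then have "e \<noteq> g" by blast
  have gu: "(g, u) \<in> verts (Cl2 R)" using g mem by (simp add: verts_Cl2)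
  show ?thesis
  proof (cases "is_complete (Cl2 R)")
    case True
    have adj: "a \<rightarrow>\<^bsub>Cl2 R\<^esub> b" if "a \<in> verts (Cl2 R)" "b \<in> verts (Cl2 R)" "a \<noteq> b" for a b
      using True that by (auto simp: is_complete_def)
    have le: "Cl2_dist a b \<le> 1" if "a \<in> verts (Cl2 R)" "b \<in> verts (Cl2 R)" for a b
      using adj that by (auto simp: Cl2_dist_def)
    have "x \<noteq> (g, u)" using x \<open>e \<noteq> g\<close> by simp
    then have "Cl2_dist x (g, u) = 1" "Cl2_dist (g, u) x = 1"
      using adj assms gu by (auto simp: Cl2_dist_def)
    then have "MMD (Cl2 R) x (g, u)"
      using assms gu le Cl2_dominatesD by (auto simp: MMD_def maximally_distant_Cl2_iff)
    then show ?thesis using gu by blast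
  next
    case False
    show ?thesis
    proof (cases "u \<in> Units'' R")
      case True
      then have "MMD (Cl2 R) x (g, u)"
        using MMD_Cl2_iff[OF False, of e u g u] assms gu g x by auto
      then show ?thesis using gu by blast
    next
      case nu: False
      \<comment> \<open>A self-inverse unit has product 1 with itself only, so any other unit
        \<open>w\<close> makes \<open>(e, w)\<close> a partner through one of the first two clauses
        of \<open>MMD_Cl2_iff\<close>.\<close>
      then have u: "inv u = u" using mem by (metis Units''_iff Units_mult_eq_one_iff)
      obtain w where w: "w \<in> Units R" "w \<noteq> u" using ex_other_unit False by blast
      then have ew: "(e, w) \<in> verts (Cl2 R)" "u \<otimes> w \<noteq> \<one>"
        using mem u by (auto simp: verts_Cl2 Units_mult_eq_one_iff)
      then have "MMD (Cl2 R) x (e, w)"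
        using MMD_Cl2_iff[OF False, of e u e w] assms x w mem by (auto simp: idempotent_square)
      then show ?thesis using ew by blast
    qed
  qed
qed

lemma verts_strong_resolving_graph_Cl2:
  "verts (strong_resolving_graph (Cl2 R)) = verts (Cl2 R)"
  using ex_MMD_Cl2 by (auto simp: strong_resolving_graph_def)

text \<open>This is an equality of graphs, whether or not \<open>Units'' R\<close> is empty, so it
  serves both (i) and (ii).\<close>

lemma strong_resolving_graph_Cl2:
  assumes "\<not> is_complete (Cl2 R)"
  shows "strong_resolving_graph (Cl2 R) = H'_graph R"
  unfolding strong_resolving_graph_def H'_graph_def
proof (rule simple_graph_cong)
  show "{x \<in> verts (Cl2 R). \<exists>y \<in> verts (Cl2 R). MMD (Cl2 R) x y} = verts (Cl2 R)"
    using ex_MMD_Cl2 by auto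
qed (auto simp: MMD_Cl2_iff[OF assms])

text \<open>If every unit is its own inverse, distinct units never have product 1, so the vertices
  with idempotent 1 form a clique; the third clause of \<open>H'_graph\<close> is void, so nothing
  joins them to the rest.\<close>

lemma is_disjoint_union_H'_graph:
  assumes "Units'' R = {}"
  shows "is_disjoint_union (H'_graph R) (complete_graph ({\<one>} \<times> Units R)) (K_graph R)"
  unfolding H'_graph_def complete_graph_def K_graph_def
proof (rule is_disjoint_union_simple_graphI)
  show "verts (Cl2 R) =
      {\<one>} \<times> Units R \<union> (idempotents R - {\<zero>, \<one>}) \<times> Units R"
    using one_neq_zero one_idempotent by (auto simp: verts_Cl2)
next
  fix x y assume "x \<in> {\<one>} \<times> Units R" "y \<in> {\<one>} \<times> Units R" "x \<noteq> y"
  moreover have "u \<otimes> v \<noteq> \<one>" if "u \<in> Units R" "v \<in> Units R" "u \<noteq> v" for u v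
    using assms that by (metis Units''_iff Units_mult_eq_one_iff empty_iff)
  ultimately show "(case x of (e, u) \<Rightarrow> \<lambda>(f, v).
        (e = \<one> \<and> f = \<one> \<and> u \<otimes> v \<noteq> \<one>)
      \<or> (e \<noteq> \<one> \<and> f \<noteq> \<one> \<and> e \<otimes> f \<noteq> \<zero> \<and> u \<otimes> v \<noteq> \<one>)
      \<or> ((e = \<one>) \<noteq> (f = \<one>) \<and> u = v \<and> u \<in> Units'' R)) y \<longleftrightarrow> True"
    by auto
qed (use assms in auto)

end

theorem theorem3p4:
  fixes R (structure)
  assumes "cring R"
    and "\<exists>e \<in> idempotents R. e \<noteq> \<zero> \<and> e \<noteq> \<one>"
  shows "(Units'' R = {} \<and> \<not> is_complete (Cl2 R) \<longrightarrow>
            (\<exists>W. W \<approx> Units R \<and>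
              is_disjoint_union (strong_resolving_graph (Cl2 R)) (complete_graph W) (K_graph R)))
       \<and> (Units'' R \<noteq> {} \<and> \<not> is_complete (Cl2 R) \<longrightarrow>
            digraph_iso (strong_resolving_graph (Cl2 R)) (H'_graph R))
       \<and> verts (Cl2 R) = verts (strong_resolving_graph (Cl2 R))"
proof -
  interpret nontrivial_idempotent_cring R
    using assms by (intro nontrivial_idempotent_cring.intro nontrivial_idempotent_cring_axioms.intro)
  \<comment> \<open>\<open>{\<one>} \<times> Units R\<close> is the witness for \<open>W\<close>,
    and the isomorphism in (ii) is the identity.\<close>
  have "{\<one>} \<times> Units R \<approx> Units R"
    by (auto simp: eqpoll_def bij_betw_def inj_on_def intro!: exI[of _ snd])
  moreover have "wf_digraph (H'_graph R)"
    by (simp add: H'_graph_def wf_digraph_simple_graph)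
  ultimately show ?thesis
    using strong_resolving_graph_Cl2 is_disjoint_union_H'_graph digraph_iso_refl
      verts_strong_resolving_graph_Cl2 by metis
qed

end
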